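(* Let $X$ be a real finite dimensional normed space with $\dim X\ge 2$, let $K\subset X$ be a pointed closed convex cone with nonempty interior, and let $A\subset X$ be a nonempty closed set such that $A=A+K\subset K\setminus\{0\}$. Assume that $$A+(K\setminus\{0\})\subset\operatorname{int}_K A .$$ If $\sigma_A$ is differentiable on $\operatorname{int}K^{-}$, then $A$ is convex and $$\forall a,a'\in A\cap\operatorname{int}K,\ a\ne a',\ \forall\lambda\in(0,1):\ \lambda a+(1-\lambda)a'\in\operatorname{int}A. \qquad( * )$$ Conversely, if $\dim X=2$ and $( * )$ holds, then $A$ is convex and $$\forall x,x'\in A,\ x\neq x',\ \forall\lambda\in(0,1):\ \lambda x+(1-\lambda)x'\in A+(A_\infty\setminus\{0\});$$ therefore, $\sigma_A$ is differentiable on $\operatorname{int}K^{-}$.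
   Context: $X^*$ is the dual of $X$, $\langle x,x^*\rangle:=x^*(x)$. A closed convex cone $K$ is pointed if $K\cap(-K)=\{0\}$. $K^{-}:=\{x^*\in X^*\mid\langle x,x^*\rangle\le0\ \forall x\in K\}$. $\operatorname{int}_K A$ is the interior of $A$ as a subset of $K$ endowed with the induced topology. The recession cone of $A$ is $A_\infty:=\{u\in X\mid \exists (t_n)\subset(0,\infty),\ t_n\to0,\ \exists(a_n)\subset A:\ t_na_n\to u\}$. The support function is $\sigma_A(x^* ):=\sup\{\langle u,x^*\rangle\mid u\in A\}\in(-\infty,+\infty]$ for $x^*\in X^*$. Differentiability may be understood in the Gâteaux or Fréchet sense (they coincide here). *)

theory Defs
  imports "HOL-Analysis.Analysis"
begin

(* Normed spaces of finite dimension with an arbitrary norm; euclidean_space would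
   fix an inner-product norm. *)
class finite_dim_normed_space = real_normed_vector +
  assumes finite_spanning_set: "\<exists>B. finite B \<and> (\<forall>x. \<exists>c. x = (\<Sum>b\<in>B. c b *\<^sub>R b))"

instance euclidean_space \<subseteq> finite_dim_normed_space
proof
  show "\<exists>B. finite B \<and> (\<forall>x::'a. \<exists>c. x = (\<Sum>b\<in>B. c b *\<^sub>R b))"
  proof (intro exI[of _ Basis] conjI allI finite_Basis)
    fix x :: 'a
    have "x = (\<Sum>b\<in>Basis. (x \<bullet> b) *\<^sub>R b)"
      by (simp add: euclidean_representation)
    then show "\<exists>c. x = (\<Sum>b\<in>Basis. c b *\<^sub>R b)"
      by (rule exI[of _ "\<lambda>b. x \<bullet> b"])
  qed
qed

lemma finite_spanning_set_span:
  "\<exists>B :: 'a::finite_dim_normed_space set. finite B \<and> span B = UNIV"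
proof -
  obtain B :: "'a set" where B: "finite B" "\<And>x. \<exists>c. x = (\<Sum>b\<in>B. c b *\<^sub>R b)"
    using finite_spanning_set by blast
  have "x \<in> span B" for x
  proof -
    obtain c where "x = (\<Sum>b\<in>B. c b *\<^sub>R b)"
      using B(2) by blast
    then show ?thesis
      by (auto intro: span_sum span_scale span_base)
  qed
  then show ?thesis
    using B(1) by blast
qed

definition pointed :: "'a::real_vector set \<Rightarrow> bool" where
  "pointed K \<longleftrightarrow> K \<inter> uminus ` K = {0}"

(* The dual space is the type of bounded linear functionals with the operator norm. *)
definition neg_polar :: "'a::real_normed_vector set \<Rightarrow> ('a \<Rightarrow>\<^sub>L real) set" where
  "neg_polar K = {f. \<forall>x\<in>K. blinfun_apply f x \<le> 0}"

definition recession_cone :: "'a::real_normed_vector set \<Rightarrow> 'a set" where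
  "recession_cone A =
     {u. \<exists>t a. (\<forall>n::nat. 0 < (t n :: real)) \<and> t \<longlonglongrightarrow> 0 \<and> (\<forall>n. a n \<in> A) \<and>
               (\<lambda>n. t n *\<^sub>R a n) \<longlonglongrightarrow> u}"

definition support_fun :: "'a::real_normed_vector set \<Rightarrow> ('a \<Rightarrow>\<^sub>L real) \<Rightarrow> ereal" where
  "support_fun A f = (SUP u\<in>A. ereal (blinfun_apply f u))"

(* Frechet differentiability at every point of S. Since real_of_ereal maps infinite
   values to 0, finiteness near the point is required separately. *)
definition ereal_differentiable_on ::
    "('b::real_normed_vector \<Rightarrow> ereal) \<Rightarrow> 'b set \<Rightarrow> bool" where
  "ereal_differentiable_on \<phi> S \<longleftrightarrow>
     (\<forall>x\<in>S. (\<forall>\<^sub>F y in nhds x. \<bar>\<phi> y\<bar> \<noteq> \<infinity>) \<and>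
            (\<lambda>y. real_of_ereal (\<phi> y)) differentiable (at x))"

end

theory Submission
  imports Defs
begin

text \<open>
  Every \<open>f\<close> in the interior of \<open>K\<^sup>-\<close> is strictly negative, hence coercive, on \<open>K - {0}\<close>; so \<open>f\<close> attains
  its maximum over \<open>A\<close>. A point of the closed convex hull of \<open>A\<close> at which \<open>f\<close> is maximal is a
  subgradient of \<open>\<sigma>\<^sub>A\<close> at \<open>f\<close>, and so differentiability at \<open>f\<close> forces that point to be unique
  (\<open>differentiable_imp_unique_support\<close>). Conversely, coercivity and compactness make a unique
  maximizer depend continuously on \<open>f\<close>, and this yields Frechet differentiability
  (\<open>unique_maximizer_imp_differentiable\<close>).

  The hypothesis \<open>A + (K - {0}) \<subseteq> int\<^sub>K A\<close> excludes the nonzero functionals on the boundary of \<open>K\<^sup>-\<close>: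
  such an \<open>f\<close> vanishes at some \<open>k \<in> K - {0}\<close>, so if it supports \<open>A\<close> at \<open>a\<close>, it is also maximal at \<open>a + k\<close>.
  But a \<open>K\<close>-neighbourhood of \<open>a + k\<close> lies in \<open>A\<close>, and moving from \<open>a + k\<close> towards a point near some
  \<open>x \<in> int K\<close> with \<open>f x = f a\<close> stays in \<open>K\<close> and increases \<open>f\<close>. Hence a supporting functional at a point
  of \<open>int K\<close>, once its value is attained on \<open>A\<close>, belongs to the interior of \<open>K\<^sup>-\<close>
  (\<open>support_at_interior_point_imp_interior\<close>).

  Let \<open>\<sigma>\<^sub>A\<close> be differentiable. A boundary point of the closed convex hull \<open>C\<close> that lies in \<open>int K\<close> is then
  the unique maximizer of its supporting functional, and so it belongs to \<open>A\<close>. From any other point of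
  \<open>C \<inter> int K\<close> one descends along the ray to the origin, which is not in \<open>C\<close>, until one meets the
  boundary of \<open>C\<close>; as \<open>A + K = A\<close>, the starting point is in \<open>A\<close>. So \<open>A\<close> is convex. If a segment between two
  points of \<open>A \<inter> int K\<close> met the boundary of \<open>A\<close> between them, both of its ends would maximize the same
  functional, against uniqueness.

  For the converse, let \<open>z\<close> lie strictly between \<open>x\<close> and \<open>x'\<close> in \<open>A\<close>. If \<open>z \<in> int K\<close>, then applying the
  strictness hypothesis to points of \<open>[x, z]\<close> and \<open>[z, x']\<close> inside \<open>int K\<close> shows that \<open>z\<close> is interior
  to \<open>A\<close>, so \<open>z - s x \<in> A\<close> for small \<open>s > 0\<close> and \<open>z \<in> A + (K - {0})\<close>. If \<open>z\<close> is on the boundary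
  of \<open>K\<close>, then \<open>x\<close> and \<open>x'\<close> lie on a common face of \<open>K\<close>, which in dimension
  two is a ray, so \<open>z\<close> exceeds one of them by an element of \<open>K - {0}\<close>. Since no \<open>f\<close> in the interior of
  \<open>K\<^sup>-\<close> is maximal at a point of \<open>A + (K - {0})\<close>, maximizers are unique, and \<open>\<sigma>\<^sub>A\<close> is differentiable.
\<close>

section \<open>Coordinates, compactness and separation\<close>

text \<open>
  A finite type indexing a spanning family, so that \<open>real ^ 'a frame\<close> is a Euclidean space that maps
  linearly onto \<open>'a\<close>. The element \<open>0\<close> keeps the type inhabited when the spanning set is empty.
\<close>

typedef (overloaded) 'a frame =
  "insert 0 (SOME B :: 'a::finite_dim_normed_space set. finite B \<and> span B = UNIV)"
  by blast

lemma frame_spanning: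
  "finite (range (Rep_frame :: 'a::finite_dim_normed_space frame \<Rightarrow> 'a))"
  "span (range (Rep_frame :: 'a::finite_dim_normed_space frame \<Rightarrow> 'a)) = UNIV"
proof -
  define B where "B = (SOME B :: 'a set. finite B \<and> span B = UNIV)"
  have B: "finite B \<and> span B = UNIV"
    unfolding B_def by (rule someI_ex) (rule finite_spanning_set_span)
  have r: "range (Rep_frame :: 'a frame \<Rightarrow> 'a) = insert 0 B"
    unfolding B_def by (rule type_definition.Rep_range[OF type_definition_frame])
  show "finite (range (Rep_frame :: 'a frame \<Rightarrow> 'a))"
    using B r by simp
  show "span (range (Rep_frame :: 'a frame \<Rightarrow> 'a)) = UNIV"
    using B r by simp
qed

instance frame :: (finite_dim_normed_space) finite
proof
  show "finite (UNIV :: 'a frame set)"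
    using frame_spanning(1) by (rule finite_imageD) (simp add: inj_on_def Rep_frame_inject)
qed

definition from_coords :: "real ^ 'a frame \<Rightarrow> 'a::finite_dim_normed_space" where
  "from_coords v = (\<Sum>i\<in>UNIV. (v $ i) *\<^sub>R Rep_frame i)"

lemma bounded_linear_from_coords:
  "bounded_linear (from_coords :: real ^ 'a frame \<Rightarrow> 'a::finite_dim_normed_space)"
proof -
  have "linear (from_coords :: real ^ 'a frame \<Rightarrow> 'a)"
    by (rule linearI) (simp_all add: from_coords_def scaleR_add_left sum.distrib scaleR_sum_right)
  then show ?thesis
    by (rule linear_conv_bounded_linear[THEN iffD1])
qed

lemma surj_from_coords:
  "surj (from_coords :: real ^ 'a frame \<Rightarrow> 'a::finite_dim_normed_space)"
proof -
  have "x \<in> range from_coords" for x :: 'a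
  proof -
    have "subspace (range (from_coords :: real ^ 'a frame \<Rightarrow> 'a))"
      using bounded_linear.linear[OF bounded_linear_from_coords] subspace_UNIV
      by (rule linear_subspace_image)
    moreover have "Rep_frame i \<in> range (from_coords :: real ^ 'a frame \<Rightarrow> 'a)" for i
    proof (rule range_eqI)
      show "Rep_frame i = from_coords (axis i 1)"
        unfolding from_coords_def axis_def
        by (simp add: if_distrib[of "\<lambda>c. c *\<^sub>R _"] cong: if_cong)
    qed
    ultimately have "span (range Rep_frame) \<subseteq> range (from_coords :: real ^ 'a frame \<Rightarrow> 'a)"
      by (intro span_minimal) auto
    then show ?thesis
      using frame_spanning(2) by auto
  qed
  then show ?thesis by blast
qed

text \<open>
  A linear right inverse \<open>T\<close> of the coordinate map exists by algebra. Its boundedness is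
  the equivalence of norms: on the unit sphere of the range of \<open>T\<close>, which is compact, the norm of the image
  under \<open>from_coords\<close> is bounded below by a positive constant.
\<close>

lemma coords_exist:
  obtains T :: "'a::finite_dim_normed_space \<Rightarrow> real ^ 'a frame"
  where "bounded_linear T" "\<And>x. from_coords (T x) = x"
proof -
  have lin: "linear (from_coords :: real ^ 'a frame \<Rightarrow> 'a)"
    by (rule bounded_linear.linear[OF bounded_linear_from_coords])
  obtain T :: "'a \<Rightarrow> real ^ 'a frame" where T: "linear T" "from_coords \<circ> T = id"
    using linear_surjective_right_inverse[OF lin surj_from_coords] by blast
  have ST: "from_coords (T x) = x" for x
    using T(2) by (simp add: fun_eq_iff)
  define Z where "Z = range T \<inter> sphere 0 1"
  have "closed (range T)"
    by (rule closed_subspace) (simp add: linear_subspace_image T(1))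
  then have "compact Z"
    unfolding Z_def by (simp add: closed_Int_compact)
  have cont: "continuous_on Z (\<lambda>v. norm (from_coords v :: 'a))"
    by (intro continuous_on_norm linear_continuous_on bounded_linear_from_coords)
  obtain m where m: "m > 0" "\<And>v. v \<in> Z \<Longrightarrow> m \<le> norm (from_coords v :: 'a)"
  proof (cases "Z = {}")
    case True
    with that[of 1] show ?thesis by simp
  next
    case False
    from continuous_attains_inf[OF \<open>compact Z\<close> this cont]
    obtain p where p: "p \<in> Z" "\<And>v. v \<in> Z \<Longrightarrow> norm (from_coords p :: 'a) \<le> norm (from_coords v :: 'a)"
      by blast
    from p(1) obtain x where x: "p = T x" "norm (T x) = 1"
      by (auto simp: Z_def)
    then have "x \<noteq> 0"
      using linear_0[OF T(1)] by auto
    then have "norm (from_coords p :: 'a) > 0"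
      by (simp add: x ST)
    then show ?thesis
      using that p(2) by blast
  qed
  have bound: "norm (T x) \<le> norm x * (1 / m)" for x
  proof (cases "T x = 0")
    case True
    then show ?thesis using m(1) by simp
  next
    case False
    define y where "y = (1 / norm (T x)) *\<^sub>R x"
    have Ty: "T y = (1 / norm (T x)) *\<^sub>R T x"
      by (simp add: y_def linear_scale[OF T(1)])
    then have "norm (T y) = 1"
      using False by simp
    then have "T y \<in> Z"
      by (simp add: Z_def)
    then have "m \<le> norm y"
      using m(2) ST by metis
    also have "norm y = norm x / norm (T x)"
      by (simp add: y_def)
    finally show ?thesis
      using False m(1) by (simp add: field_simps)
  qed
  then have "bounded_linear T"
    using T(1) by (intro bounded_linear_intro[of T "1/m"]) (auto simp: linear_add linear_scale)
  then show ?thesis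
    using that ST by blast
qed

instance finite_dim_normed_space \<subseteq> heine_borel
proof
  fix f :: "nat \<Rightarrow> 'a"
  assume "bounded (range f)"
  obtain T :: "'a \<Rightarrow> real ^ 'a frame" where T: "bounded_linear T" "\<And>x. from_coords (T x) = x"
    using coords_exist by blast
  have "bounded (range (T \<circ> f))"
    using bounded_linear_image[OF \<open>bounded (range f)\<close> T(1)] by (simp add: image_comp)
  then obtain l r where lr: "strict_mono (r :: nat \<Rightarrow> nat)" "((T \<circ> f) \<circ> r) \<longlonglongrightarrow> l"
    using bounded_imp_convergent_subsequence by blast
  have "(\<lambda>n. from_coords (((T \<circ> f) \<circ> r) n)) \<longlonglongrightarrow> from_coords l"
    by (rule bounded_linear.tendsto[OF bounded_linear_from_coords lr(2)])
  then have "(f \<circ> r) \<longlonglongrightarrow> from_coords l"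
    by (simp add: T(2) o_def)
  with lr(1) show "\<exists>l r. strict_mono (r :: nat \<Rightarrow> nat) \<and> (f \<circ> r) \<longlonglongrightarrow> l"
    by blast
qed

lemma blinfun_of_coords:
  fixes a :: "real ^ 'a::finite_dim_normed_space frame"
  assumes "bounded_linear T"
  obtains f :: "'a \<Rightarrow>\<^sub>L real" where "\<And>x. f x = a \<bullet> T x"
proof -
  have "bounded_linear (\<lambda>x. a \<bullet> T x)"
    using bounded_linear_compose[OF bounded_linear_inner_right assms] .
  from bounded_linear_Blinfun_apply[OF this] that show ?thesis
    by metis
qed

text \<open>
  The preimage of \<open>C\<close> under the coordinate map is closed and convex in a Euclidean space; a functional
  separating a preimage of \<open>z\<close> from it restricts along the right inverse \<open>T\<close>.
\<close>

lemma strict_separation_point: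
  fixes C :: "'a::finite_dim_normed_space set"
  assumes "convex C" "closed C" "z \<notin> C"
  obtains f :: "'a \<Rightarrow>\<^sub>L real" and b where "f z > b" "\<And>x. x \<in> C \<Longrightarrow> f x < b"
proof -
  obtain T :: "'a \<Rightarrow> real ^ 'a frame" where T: "bounded_linear T" "\<And>x. from_coords (T x) = x"
    using coords_exist by blast
  have "convex (from_coords -` C)"
    using assms(1) bounded_linear.linear[OF bounded_linear_from_coords]
    by (rule convex_linear_vimage[rotated])
  moreover have "closed (from_coords -` C)"
    using assms(2) linear_continuous_on[OF bounded_linear_from_coords]
    by (rule closed_vimage)
  moreover have "T z \<notin> from_coords -` C"
    using assms(3) T(2) by simp
  ultimately obtain a b where ab: "a \<bullet> T z < b" "\<And>v. v \<in> from_coords -` C \<Longrightarrow> a \<bullet> v > b"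
    using separating_hyperplane_closed_point by metis
  obtain f :: "'a \<Rightarrow>\<^sub>L real" where f: "\<And>x. f x = (- a) \<bullet> T x"
    using blinfun_of_coords[OF T(1)] by blast
  show ?thesis
  proof (rule that[of "- b" f])
    show "f z > - b" using ab(1) by (simp add: f)
    show "f x < - b" if "x \<in> C" for x
      using ab(2)[of "T x"] that by (simp add: f T(2))
  qed
qed

text \<open>
  Separation in coordinates gives a nonzero vector \<open>a\<close>, but \<open>x \<mapsto> a \<bullet> T x\<close> could still vanish, as \<open>T\<close> need
  not be onto. It does not: the preimage of \<open>interior C\<close> is invariant under the kernel of the coordinate map,
  so \<open>a\<close> is orthogonal to that kernel.
\<close>

lemma supporting_functional_interior:
  fixes C :: "'a::finite_dim_normed_space set"
  assumes "convex C" "interior C \<noteq> {}" "x \<notin> interior C"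
  obtains f :: "'a \<Rightarrow>\<^sub>L real" where "f \<noteq> 0" "\<And>y. y \<in> interior C \<Longrightarrow> f y \<le> f x"
proof -
  obtain T :: "'a \<Rightarrow> real ^ 'a frame" where T: "bounded_linear T" "\<And>x. from_coords (T x) = x"
    using coords_exist by blast
  let ?P = "from_coords -` interior C"
  interpret S: bounded_linear "from_coords :: real ^ 'a frame \<Rightarrow> 'a"
    by (rule bounded_linear_from_coords)
  obtain c where c: "c \<in> interior C"
    using assms(2) by blast
  have "convex ?P"
    using convex_interior[OF assms(1)] bounded_linear.linear[OF bounded_linear_from_coords]
    by (rule convex_linear_vimage[rotated])
  moreover have "T c \<in> ?P"
    using c T(2) by simp
  moreover have "{T x} \<inter> ?P = {}"
    using assms(3) T(2) by simp
  ultimately have "\<exists>a b. a \<noteq> 0 \<and> (\<forall>v\<in>?P. a \<bullet> v \<le> b) \<and> (\<forall>v\<in>{T x}. a \<bullet> v \<ge> b)"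
    by (intro separating_hyperplane_sets) auto
  then obtain a b where a: "a \<noteq> 0" "\<And>v. v \<in> ?P \<Longrightarrow> a \<bullet> v \<le> b" "b \<le> a \<bullet> T x"
    by auto
  have ker: "a \<bullet> k = 0" if k: "from_coords k = (0::'a)" for k
  proof (rule ccontr)
    assume nz: "a \<bullet> k \<noteq> 0"
    \<comment> \<open>the shift along \<open>k\<close> for which \<open>a\<close> takes the value \<open>b + 1\<close>\<close>
    define s where "s = (b - a \<bullet> T c + 1) / (a \<bullet> k)"
    have "T c + s *\<^sub>R k \<in> ?P"
      using c by (simp add: S.add S.scaleR k T(2))
    from a(2)[OF this] show False
      using nz by (simp add: inner_add_right s_def)
  qed
  obtain f :: "'a \<Rightarrow>\<^sub>L real" where f: "\<And>x. f x = a \<bullet> T x"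
    using blinfun_of_coords[OF T(1)] by blast
  show ?thesis
  proof (rule that)
    show "f \<noteq> 0"
    proof
      assume "f = 0"
      then have "a \<bullet> T (from_coords a) = 0"
        using f[of "from_coords a"] by simp
      moreover have "a \<bullet> (a - T (from_coords a)) = 0"
        by (rule ker) (simp add: S.diff T(2))
      ultimately show False
        using a(1) by (simp add: inner_diff_right)
    qed
    show "f y \<le> f x" if "y \<in> interior C" for y
      using a(2)[of "T y"] a(3) that by (simp add: f T(2))
  qed
qed

lemma point_separating_functional:
  fixes u v :: "'a::finite_dim_normed_space"
  assumes "u \<noteq> v"
  obtains h :: "'a \<Rightarrow>\<^sub>L real" where "h u \<noteq> h v"
proof -
  obtain h :: "'a \<Rightarrow>\<^sub>L real" and b where "h u > b" "\<And>x. x \<in> {v} \<Longrightarrow> h x < b"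
    using strict_separation_point[of "{v}" u] assms by (metis closed_singleton convex_singleton singletonD)
  from this(1) this(2)[of v] have "h u \<noteq> h v"
    by simp
  then show ?thesis
    by (rule that)
qed

text \<open>
  The kernel of a nonzero functional on a plane is a line: with two independent vectors in the kernel
  and one outside, the plane would contain three independent vectors.
\<close>

lemma parallel_in_kernel:
  fixes x y :: "'a::real_normed_vector" and f :: "'a \<Rightarrow>\<^sub>L real"
  assumes dim: "dim (UNIV :: 'a set) = 2" and "f \<noteq> 0" "f x = 0" "f y = 0" "x \<noteq> 0"
  obtains c where "y = c *\<^sub>R x"
proof (rule ccontr)
  assume not_parallel: "\<not> thesis"
  then have y: "y \<notin> span {x}"
    using that by (auto simp: span_singleton)
  obtain w where w: "f w \<noteq> 0"
    using \<open>f \<noteq> 0\<close> by (metis blinfun_eqI zero_blinfun.rep_eq)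
  have "subspace {v. f v = 0}"
    by (simp add: subspace_def blinfun.add_right blinfun.scaleR_right blinfun.zero_right)
  then have "span {y, x} \<subseteq> {v. f v = 0}"
    using assms by (intro span_minimal) auto
  then have "w \<notin> span {y, x}"
    using w by auto
  then have ind: "independent {w, y, x}"
    using y \<open>x \<noteq> 0\<close> by (simp add: independent_insert dependent_single span_base)
  have "w \<noteq> y" "w \<noteq> x" "y \<noteq> x"
    using w assms y by (auto intro: span_base)
  then have "card {w, y, x} = 3"
    by simp
  moreover obtain B :: "'a set" where B: "UNIV \<subseteq> span B" "card B = 2"
    using basis_exists[of "UNIV :: 'a set"] dim by metis
  ultimately show False
    using independent_span_bound[OF _ ind, of B] card_ge_0_finite[of B] by force
qed

section \<open>Limits along a direction\<close>

lemma le_if_le_perturbed: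
  fixes p q r :: real
  assumes "\<And>t. t > 0 \<Longrightarrow> p + t * q \<le> r"
  shows "p \<le> r"
proof (rule LIMSEQ_le_const2)
  show "(\<lambda>n. p + inverse (real (Suc n)) * q) \<longlonglongrightarrow> p"
    by (rule tendsto_eq_intros LIMSEQ_inverse_real_of_nat | simp)+
  show "\<exists>N. \<forall>n\<ge>N. p + inverse (real (Suc n)) * q \<le> r"
    using assms by simp
qed

lemma nonpos_if_bounded_ray:
  fixes p q r :: real
  assumes "\<And>t. t > 0 \<Longrightarrow> p + t * q \<le> r"
  shows "q \<le> 0"
proof (rule ccontr)
  assume q: "\<not> q \<le> 0"
  then have "p + ((\<bar>r - p\<bar> + 1) / q) * q \<le> r"
    by (intro assms) simp
  then show False
    using q by simp
qed

lemma closed_mem_if_perturbed_mem: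
  fixes z e :: "'a::real_normed_vector"
  assumes "closed S" "\<And>t. t > 0 \<Longrightarrow> z + t *\<^sub>R e \<in> S"
  shows "z \<in> S"
proof (rule closed_sequentially[OF assms(1)])
  show "z + inverse (real (Suc n)) *\<^sub>R e \<in> S" for n
    by (rule assms(2)) simp
  show "(\<lambda>n. z + inverse (real (Suc n)) *\<^sub>R e) \<longlonglongrightarrow> z"
    by (rule tendsto_eq_intros LIMSEQ_inverse_real_of_nat | simp)+
qed

section \<open>Pointed closed cones\<close>

locale pointed_closed_cone =
  fixes K :: "'a::finite_dim_normed_space set"
  assumes cone: "convex_cone K" and closed_cone: "closed K" and pointed: "pointed K"
begin

lemma zero_mem: "0 \<in> K"
  using cone by (rule convex_cone_contains_0)

lemma scale_mem: "0 \<le> c \<Longrightarrow> k \<in> K \<Longrightarrow> c *\<^sub>R k \<in> K"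
  using cone by (rule convex_cone_scaleR)

lemma add_mem: "j \<in> K \<Longrightarrow> k \<in> K \<Longrightarrow> j + k \<in> K"
  using cone by (rule convex_cone_add)

lemma convex_K: "convex K"
  using cone by (simp add: convex_cone_def)

lemma uminus_notin: "k \<in> K - {0} \<Longrightarrow> - k \<notin> K"
  using pointed unfolding pointed_def by force

lemma compact_unit_sphere: "compact (K \<inter> sphere 0 1)"
proof -
  have "sphere 0 1 = {x :: 'a. norm x = 1}"
    by auto
  moreover have "closed {x :: 'a. norm x = 1}"
    by (intro closed_Collect_eq continuous_intros)
  ultimately show ?thesis
    unfolding compact_eq_bounded_closed
    using closed_cone by (auto simp: bounded_iff intro!: closed_Int)
qed

lemma normalize_mem: "k \<in> K - {0} \<Longrightarrow> (1 / norm k) *\<^sub>R k \<in> K \<inter> sphere 0 1"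
  by (simp add: scale_mem)

lemma separating_polar_functional:
  assumes "z \<notin> K"
  obtains f where "f \<in> neg_polar K" "f z > 0"
proof -
  obtain f :: "'a \<Rightarrow>\<^sub>L real" and b where f: "f z > b" "\<And>k. k \<in> K \<Longrightarrow> f k < b"
    using strict_separation_point[OF convex_K closed_cone assms] by blast
  have "0 < b"
    using f(2)[OF zero_mem] by simp
  have "f k \<le> 0" if k: "k \<in> K" for k
  proof (rule nonpos_if_bounded_ray)
    show "0 + t * f k \<le> b" if "t > 0" for t :: real
      using f(2)[OF scale_mem[OF _ k, of t]] that by (simp add: blinfun.scaleR_right)
  qed
  then have "f \<in> neg_polar K"
    by (simp add: neg_polar_def)
  with f(1) \<open>0 < b\<close> show ?thesis
    using that by force
qed

text \<open>
  Since \<open>K\<close> is pointed, each \<open>u \<in> K - {0}\<close> has \<open>-u \<notin> K\<close>, and separating \<open>-u\<close> from \<open>K\<close> gives a functional of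
  \<open>K\<^sup>-\<close> negative at \<open>u\<close>. By compactness of the unit sphere of \<open>K\<close>, finitely many of these suffice, and
  their sum is negative everywhere.
\<close>

lemma negative_functional_exists:
  obtains g :: "'a \<Rightarrow>\<^sub>L real" where "\<And>k. k \<in> K - {0} \<Longrightarrow> g k < 0"
proof -
  have "\<exists>f :: 'a \<Rightarrow>\<^sub>L real. f \<in> neg_polar K \<and> f u < 0" if u: "u \<in> K - {0}" for u
  proof -
    obtain f where "f \<in> neg_polar K" "f (- u) > 0"
      using separating_polar_functional uminus_notin[OF u] by metis
    then show ?thesis by (auto simp: blinfun.minus_right)
  qed
  then obtain F :: "'a \<Rightarrow> 'a \<Rightarrow>\<^sub>L real"
    where F: "\<And>u. u \<in> K - {0} \<Longrightarrow> F u \<in> neg_polar K \<and> F u u < 0"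
    by metis
  let ?S = "K \<inter> sphere 0 1"
  have S: "u \<in> K - {0}" if "u \<in> ?S" for u
    using that by auto
  have "open {v. F u v < 0}" for u
    by (intro open_Collect_less continuous_intros)
  moreover have "?S \<subseteq> (\<Union>u\<in>?S. {v. F u v < 0})"
    using F[OF S] by blast
  ultimately obtain D where D: "D \<subseteq> ?S" "finite D" "?S \<subseteq> (\<Union>u\<in>D. {v. F u v < 0})"
    using compactE_image[OF compact_unit_sphere, of ?S "\<lambda>u. {v. F u v < 0}"] by metis
  show ?thesis
  proof (rule that[of "\<Sum>u\<in>D. F u"])
    fix k assume k: "k \<in> K - {0}"
    have le: "F u k \<le> 0" if "u \<in> D" for u
    proof -
      have "F u \<in> neg_polar K"
        using F[OF S] D(1) that by blast
      then show ?thesis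
        using k by (simp add: neg_polar_def)
    qed
    obtain u where u: "u \<in> D" "F u ((1 / norm k) *\<^sub>R k) < 0"
      using D(3) normalize_mem[OF k] by blast
    have "F u k < 0"
      using u(2) k by (simp add: blinfun.scaleR_right divide_less_0_iff)
    then have "(\<Sum>u\<in>D. F u k) < (\<Sum>u\<in>D. 0)"
      using D(2) le u(1) by (intro sum_strict_mono_ex1) auto
    then show "(\<Sum>u\<in>D. F u) k < 0"
      by (simp add: blinfun.sum_left)
  qed
qed

text \<open>
  Compactness bounds \<open>-f\<close> away from zero on the unit sphere of \<open>K\<close>. The resulting bound provides the
  compactness in all the maximization arguments below.
\<close>

lemma negative_functional_coercive:
  fixes f :: "'a \<Rightarrow>\<^sub>L real"
  assumes neg: "\<And>k. k \<in> K - {0} \<Longrightarrow> f k < 0"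
  obtains c where "c > 0" "\<And>k. k \<in> K \<Longrightarrow> f k \<le> - c * norm k"
proof (cases "K \<inter> sphere 0 1 = {}")
  case True
  have "f k \<le> - 1 * norm k" if k: "k \<in> K" for k
  proof -
    have "k = 0"
      using True normalize_mem[of k] k by blast
    then show ?thesis
      by (simp add: blinfun.zero_right)
  qed
  then show ?thesis
    using that[of 1] by simp
next
  case False
  have "continuous_on (K \<inter> sphere 0 1) f"
    by (intro continuous_intros)
  from continuous_attains_sup[OF compact_unit_sphere False this]
  obtain p where p: "p \<in> K \<inter> sphere 0 1" "\<And>k. k \<in> K \<inter> sphere 0 1 \<Longrightarrow> f k \<le> f p"
    by blast
  show ?thesis
  proof (rule that[of "- f p"])
    have "p \<in> K - {0}"
      using p(1) by auto
    from neg[OF this] show "- f p > 0" by simp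
    fix k assume k: "k \<in> K"
    show "f k \<le> - (- f p) * norm k"
    proof (cases "k = 0")
      case False
      with k have "f ((1 / norm k) *\<^sub>R k) \<le> f p"
        using p(2) normalize_mem by blast
      then show ?thesis
        using False by (simp add: blinfun.scaleR_right field_simps)
    qed (simp add: blinfun.zero_right)
  qed
qed

text \<open>
  Subtracting a small multiple of a negative functional from an interior point of \<open>K\<^sup>-\<close> stays in \<open>K\<^sup>-\<close>,
  which leaves no room for zeros; in the other direction, the coercivity constant is the radius of a ball in \<open>K\<^sup>-\<close>.
\<close>

lemma interior_neg_polar_iff:
  "f \<in> interior (neg_polar K) \<longleftrightarrow> (\<forall>k\<in>K - {0}. f k < 0)"
proof
  assume f: "f \<in> interior (neg_polar K)"
  obtain g :: "'a \<Rightarrow>\<^sub>L real" where g: "\<And>k. k \<in> K - {0} \<Longrightarrow> g k < 0"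
    using negative_functional_exists by blast
  show "\<forall>k\<in>K - {0}. f k < 0"
  proof
    fix k assume k: "k \<in> K - {0}"
    obtain e where e: "e > 0" "ball f e \<subseteq> neg_polar K"
      using f unfolding mem_interior by blast
    \<comment> \<open>small enough to keep \<open>f - t g\<close> within distance \<open>e\<close> of \<open>f\<close>\<close>
    define t where "t = e / (2 * (norm g + 1))"
    have t: "t > 0"
      using e(1) by (simp add: t_def add_nonneg_pos)
    have "t * norm g < e"
      using e(1) by (simp add: t_def divide_simps add_nonneg_pos)
    then have "f - t *\<^sub>R g \<in> ball f e"
      using t by (simp add: dist_norm)
    then have "f - t *\<^sub>R g \<in> neg_polar K"
      using e(2) by blast
    then have "(f - t *\<^sub>R g) k \<le> 0"
      using k by (simp add: neg_polar_def)
    then have "f k \<le> t * g k"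
      by (simp add: blinfun.diff_left blinfun.scaleR_left)
    also have "\<dots> < 0"
      using t g[OF k] by (simp add: mult_pos_neg)
    finally show "f k < 0" .
  qed
next
  assume "\<forall>k\<in>K - {0}. f k < 0"
  then have neg: "f k < 0" if "k \<in> K - {0}" for k
    using that by blast
  obtain c where c: "c > 0" "\<And>k. k \<in> K \<Longrightarrow> f k \<le> - c * norm k"
    using negative_functional_coercive[OF neg] by blast
  have "ball f c \<subseteq> neg_polar K"
  proof
    fix h assume h: "h \<in> ball f c"
    have "h k \<le> 0" if k: "k \<in> K" for k
    proof -
      have "(h - f) k \<le> norm (h - f) * norm k"
        using norm_blinfun[of "h - f" k] by simp
      also have "\<dots> \<le> c * norm k"
        using h by (intro mult_right_mono) (auto simp: dist_norm norm_minus_commute)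
      finally show ?thesis
        using c(2)[OF k] by (simp add: blinfun.diff_left)
    qed
    then show "h \<in> neg_polar K"
      by (simp add: neg_polar_def)
  qed
  then show "f \<in> interior (neg_polar K)"
    using c(1) by (auto simp: mem_interior)
qed

lemma translated_interior_mem:
  assumes "e \<in> interior K" "c > 0" "k \<in> K"
  shows "k + c *\<^sub>R e \<in> interior K"
proof -
  have "(\<lambda>x. k + c *\<^sub>R x) ` interior K \<subseteq> interior K"
  proof (rule interior_maximal)
    show "(\<lambda>x. k + c *\<^sub>R x) ` interior K \<subseteq> K"
      using assms interior_subset by (auto intro!: add_mem scale_mem)
    show "open ((\<lambda>x. k + c *\<^sub>R x) ` interior K)"
      using assms(2) by (intro open_affinity) auto
  qed
  then show ?thesis
    using assms(1) by blast
qed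

end

section \<open>Sets absorbing a cone\<close>

locale cone_absorbing_set = pointed_closed_cone K
  for K :: "'a::finite_dim_normed_space set" +
  fixes A :: "'a set"
  assumes nonempty: "A \<noteq> {}" and closed_A: "closed A"
    and absorbing: "A = A + K" and subset_cone: "A \<subseteq> K - {0}"
begin

definition maximizer :: "('a \<Rightarrow>\<^sub>L real) \<Rightarrow> 'a \<Rightarrow> bool" where
  "maximizer f u \<longleftrightarrow> u \<in> A \<and> (\<forall>a\<in>A. f a \<le> f u)"

lemma add_cone_mem: "a \<in> A \<Longrightarrow> k \<in> K \<Longrightarrow> a + k \<in> A"
  using absorbing by (metis set_plus_intro)

lemma translated_interior_mem_A:
  assumes "e \<in> interior K" "c > 0" "a \<in> A"
  shows "a + c *\<^sub>R e \<in> interior A" "a + c *\<^sub>R e \<in> interior K"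
proof -
  have "(\<lambda>x. a + c *\<^sub>R x) ` interior K \<subseteq> interior A"
  proof (rule interior_maximal)
    show "(\<lambda>x. a + c *\<^sub>R x) ` interior K \<subseteq> A"
      using assms interior_subset by (auto intro!: add_cone_mem scale_mem)
    show "open ((\<lambda>x. a + c *\<^sub>R x) ` interior K)"
      using assms(2) by (intro open_affinity) auto
  qed
  then show "a + c *\<^sub>R e \<in> interior A"
    using assms(1) by blast
  show "a + c *\<^sub>R e \<in> interior K"
    using assms subset_cone by (intro translated_interior_mem) auto
qed

text \<open>
  Along \<open>a + n u \<in> A\<close>, scaling by \<open>1/n\<close> tends to \<open>u\<close>.
\<close>

lemma cone_subset_recession_cone: "K \<subseteq> recession_cone A"
proof
  fix u assume u: "u \<in> K"
  obtain a where a: "a \<in> A"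
    using nonempty by blast
  show "u \<in> recession_cone A"
    unfolding recession_cone_def
  proof (intro CollectI exI conjI allI)
    show "0 < inverse (real (Suc n))" for n by simp
    show "(\<lambda>n. inverse (real (Suc n))) \<longlonglongrightarrow> 0"
      by (rule LIMSEQ_inverse_real_of_nat)
    show "a + real (Suc n) *\<^sub>R u \<in> A" for n
      using a u by (intro add_cone_mem scale_mem) auto
    have "(\<lambda>n. inverse (real (Suc n)) *\<^sub>R a + u) \<longlonglongrightarrow> u"
      by (rule tendsto_eq_intros LIMSEQ_inverse_real_of_nat | simp)+
    then show "(\<lambda>n. inverse (real (Suc n)) *\<^sub>R (a + real (Suc n) *\<^sub>R u)) \<longlonglongrightarrow> u"
      by (simp add: scaleR_add_right del: of_nat_Suc)
  qed
qed

section \<open>Maximizers and the gradient of the support function\<close>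

text \<open>
  By coercivity the superlevel sets of \<open>f\<close> in \<open>A\<close> are bounded, hence compact.
\<close>

lemma maximizer_exists:
  assumes "f \<in> interior (neg_polar K)"
  obtains u where "maximizer f u"
proof -
  obtain c where c: "c > 0" "\<And>k. k \<in> K \<Longrightarrow> f k \<le> - c * norm k"
    using negative_functional_coercive[of f] assms interior_neg_polar_iff by blast
  obtain a where a: "a \<in> A"
    using nonempty by blast
  let ?S = "A \<inter> {x. f a \<le> f x}"
  have "norm x \<le> - f a / c" if "x \<in> ?S" for x
  proof -
    have "f a \<le> - c * norm x"
      using that c(2)[of x] subset_cone by auto
    then show ?thesis
      using c(1) by (simp add: field_simps)
  qed
  then have "bounded ?S"
    by (auto simp: bounded_iff)
  moreover have "closed ?S"
    by (intro closed_Int closed_A closed_Collect_le continuous_intros)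
  ultimately have "compact ?S"
    by (simp add: compact_eq_bounded_closed)
  moreover have "continuous_on ?S f"
    by (intro continuous_intros)
  moreover have "?S \<noteq> {}"
    using a by auto
  ultimately obtain u where "u \<in> ?S" "\<And>x. x \<in> ?S \<Longrightarrow> f x \<le> f u"
    using continuous_attains_sup[of ?S f] by metis
  then have "maximizer f u"
    unfolding maximizer_def using order_trans by force
  then show ?thesis by (rule that)
qed

lemma support_fun_maximizer:
  assumes "maximizer f u"
  shows "support_fun A f = ereal (f u)"
  unfolding support_fun_def
  by (rule SUP_eqI) (use assms in \<open>auto simp: maximizer_def\<close>)

lemma functional_le_on_closed_convex_hull:
  fixes f :: "'a \<Rightarrow>\<^sub>L real"
  assumes "\<And>a. a \<in> A \<Longrightarrow> f a \<le> s" "x \<in> closure (convex hull A)"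
  shows "f x \<le> s"
proof -
  have "convex {x. f x \<le> s}"
    using convex_linear_vimage[OF bounded_linear.linear[OF blinfun.bounded_linear_right] convex_real_interval(2), of f s]
    by (simp add: vimage_def)
  then have "convex hull A \<subseteq> {x. f x \<le> s}"
    using assms(1) by (intro hull_minimal) auto
  moreover have "closed {x. f x \<le> s}"
    by (intro closed_Collect_le continuous_intros)
  ultimately show ?thesis
    using closure_minimal assms(2) by blast
qed

text \<open>
  The difference \<open>\<sigma>\<^sub>A g - g x\<close> is nonnegative near \<open>f\<close> and zero at \<open>f\<close>, so its derivative there vanishes.
  The point \<open>x\<close> is allowed in the closed convex hull because \<open>A\<close> is not yet known to be convex.
\<close>

lemma supporting_point_is_gradient:
  assumes D: "((\<lambda>g. real_of_ereal (support_fun A g)) has_derivative D) (at f)"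
    and f: "f \<in> interior (neg_polar K)"
    and x: "x \<in> closure (convex hull A)" "\<And>a. a \<in> A \<Longrightarrow> f a \<le> f x"
  shows "D = (\<lambda>h. h x)"
proof -
  let ?\<sigma> = "\<lambda>g. real_of_ereal (support_fun A g)"
  have ge: "g x \<le> ?\<sigma> g" if g: "g \<in> interior (neg_polar K)" for g
  proof -
    obtain u where u: "maximizer g u"
      using maximizer_exists[OF g] by blast
    then have "g x \<le> g u"
      by (intro functional_le_on_closed_convex_hull[OF _ x(1)]) (auto simp: maximizer_def)
    then show ?thesis
      by (simp add: support_fun_maximizer[OF u])
  qed
  have eq: "?\<sigma> f = f x"
  proof (rule antisym)
    obtain u where u: "maximizer f u"
      using maximizer_exists[OF f] by blast
    then show "?\<sigma> f \<le> f x"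
      using x(2) by (simp add: support_fun_maximizer[OF u]) (simp add: maximizer_def)
  qed (rule ge[OF f])
  have "((\<lambda>g. ?\<sigma> g - g x) has_derivative (\<lambda>h. D h - h x)) (at f)"
    by (intro has_derivative_diff D bounded_linear.has_derivative[OF blinfun.bounded_linear_left] has_derivative_ident)
  moreover have "\<forall>g\<in>interior (neg_polar K). ?\<sigma> f - f x \<le> ?\<sigma> g - g x"
    using ge eq by simp
  ultimately have "(\<lambda>h. D h - h x) = (\<lambda>h. 0)"
    using differential_zero_maxmin[OF f open_interior] by blast
  then show ?thesis
    by (simp add: fun_eq_iff)
qed

lemma differentiable_imp_unique_support:
  assumes "ereal_differentiable_on (support_fun A) (interior (neg_polar K))"
    and "f \<in> interior (neg_polar K)"
    and "x \<in> closure (convex hull A)" "\<And>a. a \<in> A \<Longrightarrow> f a \<le> f x"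
    and "y \<in> closure (convex hull A)" "\<And>a. a \<in> A \<Longrightarrow> f a \<le> f y"
  shows "x = y"
proof (rule ccontr)
  assume "x \<noteq> y"
  then obtain h :: "'a \<Rightarrow>\<^sub>L real" where h: "h x \<noteq> h y"
    using point_separating_functional by blast
  obtain D where D: "((\<lambda>g. real_of_ereal (support_fun A g)) has_derivative D) (at f)"
    using assms(1,2) unfolding ereal_differentiable_on_def differentiable_def by blast
  from supporting_point_is_gradient[OF D assms(2-4)]
    supporting_point_is_gradient[OF D assms(2,5,6)]
  have "(\<lambda>h :: 'a \<Rightarrow>\<^sub>L real. h x) = (\<lambda>h. h y)"
    by metis
  with h show False
    by (meson fun_cong)
qed

text \<open>
  Functionals near \<open>f\<close> share half of its coercivity constant, so their maximizers lie in a common ball.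
  On the part of \<open>A\<close> in that ball at distance at least \<open>e\<close> from \<open>u\<close>, compactness and uniqueness keep
  \<open>f\<close> at most some \<open>m < f u\<close>, and this gap survives small perturbations of \<open>f\<close>.
\<close>

lemma maximizer_continuous:
  assumes f: "f \<in> interior (neg_polar K)" and u: "maximizer f u"
    and unique: "\<And>v. maximizer f v \<Longrightarrow> v = u" and e: "e > 0"
  obtains d where "d > 0" "\<And>g w. norm (g - f) < d \<Longrightarrow> maximizer g w \<Longrightarrow> norm (w - u) < e"
proof -
  obtain c where c: "c > 0" "\<And>k. k \<in> K \<Longrightarrow> f k \<le> - c * norm k"
    using negative_functional_coercive[of f] f interior_neg_polar_iff by blast
  have uA: "u \<in> A" and u_max: "\<And>a. a \<in> A \<Longrightarrow> f a \<le> f u"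
    using u by (auto simp: maximizer_def)
  have near: "\<bar>g x - f x\<bar> \<le> norm (g - f) * norm x" for g :: "'a \<Rightarrow>\<^sub>L real" and x
    using norm_blinfun[of "g - f" x] by (simp add: blinfun.diff_left)
  define R where "R = (\<bar>f u\<bar> + c / 2 * norm u) / (c / 2)"
  have R: "R \<ge> 0"
    using c(1) by (simp add: R_def)
  have bound: "norm w \<le> R" if g: "norm (g - f) < c / 2" and w: "maximizer g w" for g w
  proof -
    have "w \<in> A" "g u \<le> g w"
      using w uA by (auto simp: maximizer_def)
    moreover have "norm (g - f) * norm w \<le> c / 2 * norm w" "norm (g - f) * norm u \<le> c / 2 * norm u"
      using g by (intro mult_right_mono; simp)+
    ultimately have "c / 2 * norm w \<le> \<bar>f u\<bar> + c / 2 * norm u"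
      using near[of g w] near[of g u] c(2)[of w] subset_cone by auto
    then show ?thesis
      using c(1) by (simp add: R_def field_simps)
  qed
  let ?S = "A \<inter> cball 0 R \<inter> {w. e \<le> norm (w - u)}"
  obtain m where m: "m < f u" "\<And>w. w \<in> ?S \<Longrightarrow> f w \<le> m"
  proof (cases "?S = {}")
    case True
    with that[of "f u - 1"] show ?thesis by auto
  next
    case False
    have "closed ?S"
      by (intro closed_Int closed_A closed_cball closed_Collect_le continuous_intros)
    then have "compact ?S"
      by (simp add: compact_eq_bounded_closed bounded_Int)
    moreover have "continuous_on ?S f"
      by (intro continuous_intros)
    ultimately obtain p where p: "p \<in> ?S" "\<And>w. w \<in> ?S \<Longrightarrow> f w \<le> f p"
      using continuous_attains_sup[OF _ False] by blast
    have "f p \<noteq> f u"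
    proof
      assume "f p = f u"
      then have "maximizer f p"
        using p(1) u_max by (simp add: maximizer_def)
      then show False
        using unique p(1) e by auto
    qed
    then have "f p < f u"
      using u_max[of p] p(1) by auto
    then show ?thesis
      using that p(2) by blast
  qed
  define d where "d = min (c / 2) ((f u - m) / (R + norm u + 1))"
  have pos: "R + norm u + 1 > 0"
    using R by (simp add: add_nonneg_pos)
  show ?thesis
  proof (rule that[of d])
    show "d > 0"
      using c(1) m(1) pos by (simp add: d_def)
    fix g w assume g: "norm (g - f) < d" and w: "maximizer g w"
    have wR: "norm w \<le> R"
      using g by (intro bound[OF _ w]) (simp add: d_def)
    have wA: "w \<in> A" and gw: "g u \<le> g w"
      using w uA by (auto simp: maximizer_def)
    show "norm (w - u) < e"
    proof (rule ccontr)
      assume "\<not> norm (w - u) < e"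
      then have "f w \<le> m"
        using wA wR by (intro m(2)) auto
      moreover have "norm (g - f) * norm w \<le> norm (g - f) * R"
        using wR by (intro mult_left_mono) auto
      ultimately have "f u - m \<le> norm (g - f) * (R + norm u)"
        using near[of g w] near[of g u] gw by (simp add: algebra_simps)
      also have "\<dots> \<le> norm (g - f) * (R + norm u + 1)"
        by (intro mult_left_mono) auto
      also have "\<dots> < d * (R + norm u + 1)"
        using g pos by (intro mult_strict_right_mono)
      also have "\<dots> \<le> f u - m"
        unfolding pos_le_divide_eq[OF pos, symmetric] by (simp add: d_def)
      finally show False by simp
    qed
  qed
qed

text \<open>
  The derivative at \<open>f\<close> is evaluation at its maximizer \<open>u\<close>. If \<open>w\<close> maximizes \<open>g\<close>, the remainder lies
  between \<open>0\<close> and \<open>(g - f) (w - u)\<close>, which is of lower order because \<open>w\<close> tends to \<open>u\<close>.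
\<close>

lemma unique_maximizer_imp_differentiable:
  assumes unique: "\<And>f u v. f \<in> interior (neg_polar K) \<Longrightarrow> maximizer f u \<Longrightarrow> maximizer f v \<Longrightarrow> u = v"
  shows "ereal_differentiable_on (support_fun A) (interior (neg_polar K))"
  unfolding ereal_differentiable_on_def
proof (intro ballI conjI)
  fix f assume f: "f \<in> interior (neg_polar K)"
  show "\<forall>\<^sub>F g in nhds f. \<bar>support_fun A g\<bar> \<noteq> \<infinity>"
    unfolding eventually_nhds
  proof (intro exI conjI ballI)
    fix g assume "g \<in> interior (neg_polar K)"
    then obtain u where "maximizer g u"
      by (rule maximizer_exists)
    then show "\<bar>support_fun A g\<bar> \<noteq> \<infinity>"
      by (simp add: support_fun_maximizer)
  qed (use f in auto)
  let ?\<sigma> = "\<lambda>g. real_of_ereal (support_fun A g)"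
  obtain u where u: "maximizer f u"
    using maximizer_exists[OF f] by blast
  have "(?\<sigma> has_derivative (\<lambda>h. h u)) (at f)"
    unfolding has_derivative_at_alt
  proof (intro conjI allI impI)
    show "bounded_linear (\<lambda>h :: 'a \<Rightarrow>\<^sub>L real. h u)"
      by (rule blinfun.bounded_linear_left)
    fix e :: real assume e: "e > 0"
    obtain d where d: "d > 0" "\<And>g w. norm (g - f) < d \<Longrightarrow> maximizer g w \<Longrightarrow> norm (w - u) < e"
      using maximizer_continuous[OF f u unique[OF f _ u] e] by blast
    obtain r where r: "r > 0" "ball f r \<subseteq> interior (neg_polar K)"
      using f open_interior open_contains_ball by blast
    have "norm (?\<sigma> g - ?\<sigma> f - (g - f) u) \<le> e * norm (g - f)"
      if g: "norm (g - f) < min d r" for g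
    proof -
      have "g \<in> interior (neg_polar K)"
        using g r(2) by (auto simp: dist_norm norm_minus_commute)
      then obtain w where w: "maximizer g w"
        by (rule maximizer_exists)
      have "g u \<le> g w" "f w \<le> f u"
        using u w by (auto simp: maximizer_def)
      then have "norm (?\<sigma> g - ?\<sigma> f - (g - f) u) \<le> (g - f) (w - u)"
        by (simp add: support_fun_maximizer[OF u] support_fun_maximizer[OF w]
            blinfun.diff_left blinfun.diff_right)
      also have "\<dots> \<le> norm (g - f) * norm (w - u)"
        using norm_blinfun[of "g - f" "w - u"] by simp
      also have "\<dots> \<le> norm (g - f) * e"
        using d(2)[OF _ w] g by (intro mult_left_mono) auto
      finally show ?thesis
        by (simp add: mult.commute)
    qed
    then show "\<exists>d>0. \<forall>g. norm (g - f) < d \<longrightarrow>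
        norm (?\<sigma> g - ?\<sigma> f - (g - f) u) \<le> e * norm (g - f)"
      using d(1) r(1) by (intro exI[of _ "min d r"]) auto
  qed
  then show "?\<sigma> differentiable (at f)"
    unfolding differentiable_def by blast
qed


section \<open>Supporting functionals of sets absorbing a cone\<close>

text \<open>
  The functional is bounded above on \<open>A\<close>, which contains translates of \<open>K\<close>; hence it is nonpositive on \<open>K\<close>.
\<close>

lemma supporting_functional_in_neg_polar:
  assumes "interior K \<noteq> {}" "convex C" "A \<subseteq> C" "x \<notin> interior C"
  obtains f where "f \<noteq> 0" "f \<in> neg_polar K" "\<And>a. a \<in> A \<Longrightarrow> f a \<le> f x"
proof -
  obtain e where e: "e \<in> interior K"
    using assms(1) by blast
  obtain a0 where a0: "a0 \<in> A"
    using nonempty by blast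
  have int: "a + t *\<^sub>R e \<in> interior C" if "a \<in> A" "t > 0" for a t
    using translated_interior_mem_A(1)[OF e that(2,1)] interior_mono[OF assms(3)] by blast
  then have "interior C \<noteq> {}"
    using a0 zero_less_one by blast
  then obtain f :: "'a \<Rightarrow>\<^sub>L real" where f: "f \<noteq> 0" "\<And>y. y \<in> interior C \<Longrightarrow> f y \<le> f x"
    using supporting_functional_interior[OF assms(2) _ assms(4)] by metis
  have le: "f a \<le> f x" if a: "a \<in> A" for a
  proof (rule le_if_le_perturbed)
    show "f a + t * f e \<le> f x" if "t > 0" for t
      using f(2)[OF int[OF a that]] by (simp add: blinfun.add_right blinfun.scaleR_right)
  qed
  have "f k \<le> 0" if k: "k \<in> K" for k
  proof (rule nonpos_if_bounded_ray)
    show "f a0 + t * f k \<le> f x" if "t > 0" for t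
      using le[OF add_cone_mem[OF a0 scale_mem[OF _ k, of t]]] that
      by (simp add: blinfun.add_right blinfun.scaleR_right)
  qed
  then have "f \<in> neg_polar K"
    by (simp add: neg_polar_def)
  with f(1) le show ?thesis
    using that by blast
qed

text \<open>
  The functional \<open>f\<close> itself need not be coercive on \<open>A\<close>, so a maximizing sequence could escape to infinity. The
  coercive perturbations \<open>f + t g\<close> do have maximizers \<open>a\<close>, and comparing their values with those at \<open>x\<close>
  gives \<open>g x \<le> g a\<close>, a bound on \<open>norm a\<close> that does not depend on \<open>t\<close>.
\<close>

lemma supporting_value_attained:
  assumes x: "x \<in> closure (convex hull A)" and f: "f \<in> neg_polar K"
    and le: "\<And>a. a \<in> A \<Longrightarrow> f a \<le> f x"
  obtains a where "a \<in> A" "f a = f x"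
proof -
  obtain g :: "'a \<Rightarrow>\<^sub>L real" where g: "\<And>k. k \<in> K - {0} \<Longrightarrow> g k < 0"
    using negative_functional_exists by blast
  obtain c where c: "c > 0" "\<And>k. k \<in> K \<Longrightarrow> g k \<le> - c * norm k"
    using negative_functional_coercive[OF g] by blast
  let ?S = "A \<inter> cball 0 (- g x / c)"
  have approx: "\<exists>a\<in>?S. f x + t * g x \<le> f a" if t: "t > 0" for t
  proof -
    have app: "(f + t *\<^sub>R g) v = f v + t * g v" for v
      by (simp add: blinfun.add_left blinfun.scaleR_left)
    have "(f + t *\<^sub>R g) k < 0" if k: "k \<in> K - {0}" for k
      using f k mult_pos_neg[OF t g[OF k]] by (auto simp: app neg_polar_def intro: add_nonpos_neg)
    then have "f + t *\<^sub>R g \<in> interior (neg_polar K)"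
      by (simp add: interior_neg_polar_iff)
    then obtain a where a: "maximizer (f + t *\<^sub>R g) a"
      by (rule maximizer_exists)
    then have aA: "a \<in> A"
      by (simp add: maximizer_def)
    have ge: "f x + t * g x \<le> f a + t * g a"
      using functional_le_on_closed_convex_hull[OF _ x, of "f + t *\<^sub>R g"] a
      by (simp add: maximizer_def app)
    then have "t * g x \<le> t * g a"
      using le[OF aA] by linarith
    then have "g x \<le> - c * norm a"
      using t c(2)[of a] aA subset_cone by force
    then have "a \<in> ?S"
      using aA c(1) by (simp add: field_simps)
    moreover have "t * g a \<le> 0"
    proof -
      have "a \<in> K - {0}"
        using aA subset_cone by blast
      from mult_pos_neg[OF t g[OF this]] show ?thesis
        by simp
    qed
    ultimately show ?thesis
      using ge by (intro bexI[of _ a]) auto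
  qed
  have "compact ?S"
    unfolding compact_eq_bounded_closed
    using closed_A bounded_subset[OF bounded_cball] by (auto intro!: closed_Int)
  moreover have "?S \<noteq> {}"
    using approx[OF zero_less_one] by blast
  moreover have "continuous_on ?S f"
    by (intro continuous_intros)
  ultimately obtain a where a: "a \<in> ?S" "\<And>b. b \<in> ?S \<Longrightarrow> f b \<le> f a"
    using continuous_attains_sup[of ?S f] by metis
  have "f x \<le> f a"
  proof (rule le_if_le_perturbed)
    show "f x + t * g x \<le> f a" if "t > 0" for t
      using approx[OF that] a(2) by force
  qed
  with a(1) le show ?thesis
    using that by force
qed

end

section \<open>Supporting functionals at interior points of the cone\<close>

locale relatively_absorbing_set = cone_absorbing_set K A
  for K A :: "'a::finite_dim_normed_space set" +
  assumes solid: "interior K \<noteq> {}"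
    and relatively_interior: "A + (K - {0}) \<subseteq> (top_of_set K) interior_of A"
begin

text \<open>
  Here the hypothesis on the relative interior enters. If \<open>f\<close> vanished at some \<open>k \<in> K - {0}\<close>, it would be
  maximal at \<open>b = a + k\<close>, of which a \<open>K\<close>-neighbourhood lies in \<open>A\<close>. As \<open>x\<close> is interior to \<open>K\<close>, some \<open>y \<in> K\<close>
  near \<open>x\<close> has \<open>f y > f x\<close>, and the points of \<open>[b, y]\<close> close to \<open>b\<close> are in \<open>A\<close> with a larger value of \<open>f\<close>.
\<close>

lemma support_at_interior_point_imp_interior:
  assumes x: "x \<in> interior K" and f: "f \<in> neg_polar K" "f \<noteq> 0"
    and a: "a \<in> A" "f a = f x" and le: "\<And>b. b \<in> A \<Longrightarrow> f b \<le> f x"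
  shows "f \<in> interior (neg_polar K)"
proof (rule ccontr)
  assume "f \<notin> interior (neg_polar K)"
  then obtain k where k: "k \<in> K - {0}" "\<not> f k < 0"
    unfolding interior_neg_polar_iff by blast
  moreover have "f k \<le> 0"
    using f(1) k(1) by (simp add: neg_polar_def)
  ultimately have fk: "f k = 0"
    by simp
  define b where "b = a + k"
  have fb: "f b = f x"
    using a(2) fk by (simp add: b_def blinfun.add_right)
  have bK: "b \<in> K"
    using a(1) k(1) subset_cone by (auto simp: b_def intro: add_mem)
  have "b \<in> (top_of_set K) interior_of A"
    using relatively_interior a(1) k(1) unfolding b_def by (blast intro: set_plus_intro)
  then obtain U where U: "open U" "b \<in> U" "K \<inter> U \<subseteq> A"
    unfolding interior_of_def by (auto simp: openin_open)
  obtain w where w: "f w \<noteq> 0"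
    using f(2) by (metis blinfun_eqI zero_blinfun.rep_eq)
  define v where "v = sgn (f w) *\<^sub>R w"
  have fv: "f v > 0"
    using w by (simp add: v_def blinfun.scaleR_right sgn_if)
  have "\<forall>\<^sub>F s in at_right (0::real). x + s *\<^sub>R v \<in> interior K"
    by (rule topological_tendstoD[of _ x]) (use x in \<open>auto intro!: tendsto_eq_intros\<close>)
  moreover have "\<forall>\<^sub>F s in at_right (0::real). s > 0"
    by (rule eventually_at_right_less)
  ultimately obtain s where s: "s > 0" "x + s *\<^sub>R v \<in> interior K"
    using eventually_happens[OF eventually_conj] trivial_limit_at_right_real by blast
  define y where "y = x + s *\<^sub>R v"
  have "\<forall>\<^sub>F t in at_right (0::real). (1 - t) *\<^sub>R b + t *\<^sub>R y \<in> U"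
    by (rule topological_tendstoD[of _ b]) (use U in \<open>auto intro!: tendsto_eq_intros\<close>)
  moreover have "\<forall>\<^sub>F t in at_right (0::real). t \<in> {0<..<1}"
    by (rule eventually_at_right_real) simp
  ultimately obtain t where t: "0 < t" "t < 1" "(1 - t) *\<^sub>R b + t *\<^sub>R y \<in> U"
    using eventually_happens[OF eventually_conj] trivial_limit_at_right_real by force
  have "y \<in> K"
    using s(2) interior_subset by (auto simp: y_def)
  then have "(1 - t) *\<^sub>R b + t *\<^sub>R y \<in> K"
    using convexD_alt[OF convex_K bK] t by simp
  then have "f ((1 - t) *\<^sub>R b + t *\<^sub>R y) \<le> f x"
    using U(3) t(3) by (intro le) blast
  moreover have "f ((1 - t) *\<^sub>R b + t *\<^sub>R y) = (1 - t) * f x + t * (f x + s * f v)"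
    by (simp add: blinfun.add_right blinfun.scaleR_right fb y_def)
  then have "f ((1 - t) *\<^sub>R b + t *\<^sub>R y) = f x + t * (s * f v)"
    by (simp add: algebra_simps)
  ultimately show False
    using fv s(1) t(1) by (simp add: mult_le_0_iff not_le)
qed

text \<open>
  A functional supporting the hull at \<open>x\<close> attains its value at some \<open>a \<in> A\<close>; as its maximum over
  the hull is attained only once, \<open>a = x\<close>.
\<close>

lemma differentiable_imp_boundary_mem:
  assumes diff: "ereal_differentiable_on (support_fun A) (interior (neg_polar K))"
    and x: "x \<in> interior K" "x \<in> closure (convex hull A)" "x \<notin> interior (closure (convex hull A))"
  shows "x \<in> A"
proof -
  have sub: "A \<subseteq> closure (convex hull A)"
    using hull_subset[of A convex] closure_subset[of "convex hull A"] by blast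
  obtain f where f: "f \<noteq> 0" "f \<in> neg_polar K" and le: "\<And>a. a \<in> A \<Longrightarrow> f a \<le> f x"
    using supporting_functional_in_neg_polar[OF solid convex_closure[OF convex_convex_hull] sub x(3)]
    by blast
  obtain a where a: "a \<in> A" "f a = f x"
    using supporting_value_attained[OF x(2) f(2) le] by blast
  have "f \<in> interior (neg_polar K)"
    using support_at_interior_point_imp_interior[OF x(1) f(2,1) a le] .
  then have "a = x"
    using a le sub x(2) by (intro differentiable_imp_unique_support[OF diff, of f]) auto
  with a(1) show ?thesis by simp
qed

text \<open>
  The smallest \<open>t\<close> with \<open>t x\<close> in the closed convex hull is positive, because the hull does not contain the
  origin. Then \<open>t x\<close> is on the boundary of the hull, hence in \<open>A\<close>, and \<open>x = t x + (1 - t) x \<in> A + K\<close>.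
\<close>

lemma differentiable_imp_hull_mem:
  assumes diff: "ereal_differentiable_on (support_fun A) (interior (neg_polar K))"
    and x: "x \<in> interior K" "x \<in> closure (convex hull A)"
  shows "x \<in> A"
proof -
  let ?C = "closure (convex hull A)"
  obtain g :: "'a \<Rightarrow>\<^sub>L real" where g: "\<And>k. k \<in> K - {0} \<Longrightarrow> g k < 0"
    using negative_functional_exists by blast
  then have "g \<in> interior (neg_polar K)"
    by (simp add: interior_neg_polar_iff)
  then obtain u where u: "maximizer g u"
    by (rule maximizer_exists)
  then have "g u < 0"
    using g subset_cone by (auto simp: maximizer_def)
  then have zero: "0 \<notin> ?C"
    using functional_le_on_closed_convex_hull[of g "g u" 0] u
    by (auto simp: maximizer_def blinfun.zero_right)
  let ?T = "{0..1} \<inter> (\<lambda>t. t *\<^sub>R x) -` ?C"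
  have "closed ((\<lambda>t::real. t *\<^sub>R x) -` ?C)"
    by (intro closed_vimage closed_closure continuous_intros)
  then have "compact ?T"
    by (simp add: compact_Int_closed)
  moreover have "?T \<noteq> {}"
  proof -
    have "1 \<in> ?T"
      using x(2) by simp
    then show ?thesis by blast
  qed
  ultimately obtain t where t: "t \<in> ?T" "\<And>s. s \<in> ?T \<Longrightarrow> t \<le> s"
    using compact_attains_inf[of ?T] by blast
  have "t \<noteq> 0"
    using t(1) zero by auto
  then have t_pos: "0 < t" and t1: "t \<le> 1"
    using t(1) by auto
  have "t *\<^sub>R x \<notin> interior ?C"
  proof
    assume int: "t *\<^sub>R x \<in> interior ?C"
    have "\<forall>\<^sub>F s in at_left t. s *\<^sub>R x \<in> interior ?C"
      by (rule topological_tendstoD[of _ "t *\<^sub>R x"]) (use int in \<open>auto intro!: tendsto_intros\<close>)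
    moreover have "\<forall>\<^sub>F s in at_left t. s \<in> {0<..<t}"
      using t_pos by (rule eventually_at_left_real)
    ultimately obtain s where s: "s *\<^sub>R x \<in> interior ?C" "s \<in> {0<..<t}"
      using eventually_happens[OF eventually_conj] trivial_limit_at_left_real by blast
    then have "s \<in> ?T"
      using interior_subset[of ?C] t1 by auto
    from t(2)[OF this] s(2) show False by simp
  qed
  moreover have "t *\<^sub>R x \<in> interior K"
    using translated_interior_mem[OF x(1) t_pos zero_mem] by simp
  moreover have "t *\<^sub>R x \<in> ?C"
    using t(1) by simp
  ultimately have "t *\<^sub>R x \<in> A"
    by (intro differentiable_imp_boundary_mem[OF diff])
  moreover have "(1 - t) *\<^sub>R x \<in> K"
    using x(1) interior_subset t1 by (intro scale_mem) auto
  ultimately have "t *\<^sub>R x + (1 - t) *\<^sub>R x \<in> A"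
    by (rule add_cone_mem)
  then show ?thesis
    by (simp flip: scaleR_add_left)
qed

text \<open>
  Points of \<open>A\<close> are limits of points of \<open>A \<inter> int K\<close>, obtained by adding small multiples of an interior
  element of \<open>K\<close>.
\<close>

lemma convex_if_interior_segments:
  assumes "\<And>a a' r. a \<in> A \<inter> interior K \<Longrightarrow> a' \<in> A \<inter> interior K \<Longrightarrow> 0 < r \<Longrightarrow> r < 1 \<Longrightarrow>
      r *\<^sub>R a + (1 - r) *\<^sub>R a' \<in> A"
  shows "convex A"
proof -
  obtain e where e: "e \<in> interior K"
    using solid by blast
  have segment: "r *\<^sub>R a + (1 - r) *\<^sub>R a' \<in> A"
    if a: "a \<in> A" "a' \<in> A" and r: "0 < r" "r < 1" for a a' r
  proof (rule closed_mem_if_perturbed_mem[OF closed_A])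
    fix t :: real assume t: "t > 0"
    have "b + t *\<^sub>R e \<in> A \<inter> interior K" if "b \<in> A" for b
      using translated_interior_mem_A[OF e t that] interior_subset by blast
    from assms[OF this[OF a(1)] this[OF a(2)] r]
    show "r *\<^sub>R a + (1 - r) *\<^sub>R a' + t *\<^sub>R e \<in> A"
      by (simp add: algebra_simps)
  qed
  then show ?thesis
    unfolding convex_alt
  proof (intro ballI allI impI)
    fix x y and u :: real
    assume "x \<in> A" "y \<in> A" "0 \<le> u \<and> u \<le> 1"
    then show "(1 - u) *\<^sub>R x + u *\<^sub>R y \<in> A"
      using segment[of x y "1 - u"] by (cases "u = 0 \<or> u = 1") auto
  qed
qed

lemma differentiable_imp_convex:
  assumes diff: "ereal_differentiable_on (support_fun A) (interior (neg_polar K))"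
  shows "convex A"
proof (rule convex_if_interior_segments)
  fix a a' and r :: real
  assume a: "a \<in> A \<inter> interior K" "a' \<in> A \<inter> interior K" and r: "0 < r" "r < 1"
  show "r *\<^sub>R a + (1 - r) *\<^sub>R a' \<in> A"
  proof (rule differentiable_imp_hull_mem[OF diff])
    show "r *\<^sub>R a + (1 - r) *\<^sub>R a' \<in> interior K"
      using a r by (intro convexD[OF convex_interior[OF convex_K]]) auto
    have "r *\<^sub>R a + (1 - r) *\<^sub>R a' \<in> convex hull A"
      using a r hull_subset[of A convex] by (intro convexD[OF convex_convex_hull]) auto
    then show "r *\<^sub>R a + (1 - r) *\<^sub>R a' \<in> closure (convex hull A)"
      using closure_subset by blast
  qed
qed

text \<open>
  A functional supporting \<open>A\<close> at a point between \<open>a\<close> and \<open>a'\<close> is maximal at both ends.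
\<close>

lemma differentiable_imp_strict:
  assumes diff: "ereal_differentiable_on (support_fun A) (interior (neg_polar K))"
    and a: "a \<in> A \<inter> interior K" "a' \<in> A \<inter> interior K" "a \<noteq> a'" and r: "0 < r" "r < 1"
  shows "r *\<^sub>R a + (1 - r) *\<^sub>R a' \<in> interior A"
proof (rule ccontr)
  let ?x = "r *\<^sub>R a + (1 - r) *\<^sub>R a'"
  assume "?x \<notin> interior A"
  then obtain f where f: "f \<noteq> 0" "f \<in> neg_polar K" and le: "\<And>b. b \<in> A \<Longrightarrow> f b \<le> f ?x"
    using supporting_functional_in_neg_polar[OF solid differentiable_imp_convex[OF diff] order_refl]
    by blast
  have fx: "f ?x = r * f a + (1 - r) * f a'"
    by (simp add: blinfun.add_right blinfun.scaleR_right)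
  have "r * (f ?x - f a) + (1 - r) * (f ?x - f a') = 0"
    by (simp only: fx) (simp add: algebra_simps)
  moreover have "0 \<le> r * (f ?x - f a)" "0 \<le> (1 - r) * (f ?x - f a')"
    using le[of a] le[of a'] a r by auto
  ultimately have "r * (f ?x - f a) = 0" "(1 - r) * (f ?x - f a') = 0"
    by linarith+
  then have eq: "f a = f ?x" "f a' = f ?x"
    using r by auto
  have "?x \<in> interior K"
    using a r by (intro convexD[OF convex_interior[OF convex_K]]) auto
  from support_at_interior_point_imp_interior[OF this f(2,1) _ eq(1) le] a(1)
  have "f \<in> interior (neg_polar K)" by blast
  moreover have "A \<subseteq> closure (convex hull A)"
    using hull_subset[of A convex] closure_subset[of "convex hull A"] by blast
  ultimately have "a = a'"
    using a(1,2) le eq by (intro differentiable_imp_unique_support[OF diff, of f]) auto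
  with a(3) show False by simp
qed

section \<open>Strictly convex sets in the plane\<close>

text \<open>
  A functional supporting \<open>K\<close> at a boundary point inside the segment vanishes at both ends, and its kernel is
  a line. The factor is positive because \<open>K\<close> is pointed.
\<close>

lemma boundary_segment_parallel:
  assumes dim: "dim (UNIV :: 'a set) = 2" and x: "x \<in> K - {0}" "x' \<in> K - {0}" and r: "0 < r" "r < 1"
    and z: "r *\<^sub>R x + (1 - r) *\<^sub>R x' \<notin> interior K"
  obtains c where "c > 0" "x' = c *\<^sub>R x"
proof -
  let ?z = "r *\<^sub>R x + (1 - r) *\<^sub>R x'"
  obtain f :: "'a \<Rightarrow>\<^sub>L real" where f: "f \<noteq> 0" "\<And>y. y \<in> interior K \<Longrightarrow> f y \<le> f ?z"
    using supporting_functional_interior[OF convex_K solid z] by blast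
  obtain e where e: "e \<in> interior K"
    using solid by blast
  have le: "f k \<le> f ?z" if k: "k \<in> K" for k
  proof (rule le_if_le_perturbed)
    show "f k + t * f e \<le> f ?z" if "t > 0" for t
      using f(2)[OF translated_interior_mem[OF e that k]]
      by (simp add: blinfun.add_right blinfun.scaleR_right)
  qed
  have nonpos: "f k \<le> 0" if k: "k \<in> K" for k
  proof (rule nonpos_if_bounded_ray)
    show "0 + t * f k \<le> f ?z" if "t > 0" for t
      using le[OF scale_mem[OF _ k, of t]] that by (simp add: blinfun.scaleR_right)
  qed
  have "0 \<le> f ?z"
    using le[OF zero_mem] by (simp add: blinfun.zero_right)
  then have sum: "0 \<le> r * f x + (1 - r) * f x'"
    by (simp add: blinfun.add_right blinfun.scaleR_right)
  moreover have "r * f x \<le> 0" "(1 - r) * f x' \<le> 0"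
    using nonpos x r by (auto intro!: mult_nonneg_nonpos)
  ultimately have "r * f x = 0" "(1 - r) * f x' = 0"
    by linarith+
  then have "f x = 0" "f x' = 0"
    using r by auto
  then obtain c where c: "x' = c *\<^sub>R x"
    using parallel_in_kernel[OF dim f(1), of x x'] x by blast
  have "c > 0"
  proof (rule ccontr)
    assume "\<not> c > 0"
    then have "(- c) *\<^sub>R x \<in> K"
      using x by (intro scale_mem) auto
    then show False
      using uminus_notin[OF x(2)] c by simp
  qed
  with c show ?thesis
    using that by blast
qed

text \<open>
  The strictness hypothesis concerns points of \<open>int K\<close> only. When \<open>z \<in> int K\<close>, the ends are replaced by
  their midpoints with \<open>z\<close>, which are interior to \<open>K\<close>. Otherwise \<open>x'\<close> is a positive multiple of \<open>x\<close>, and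
  \<open>z\<close> exceeds the shorter of the two by an element of \<open>K - {0}\<close>.
\<close>

lemma strict_imp_absorbed_segment:
  assumes dim: "dim (UNIV :: 'a set) = 2"
    and strict: "\<And>a a' r. a \<in> A \<inter> interior K \<Longrightarrow> a' \<in> A \<inter> interior K \<Longrightarrow> a \<noteq> a' \<Longrightarrow>
      0 < r \<Longrightarrow> r < 1 \<Longrightarrow> r *\<^sub>R a + (1 - r) *\<^sub>R a' \<in> interior A"
    and convex_A: "convex A"
    and x: "x \<in> A" "x' \<in> A" "x \<noteq> x'" and r: "0 < r" "r < 1"
  shows "r *\<^sub>R x + (1 - r) *\<^sub>R x' \<in> A + (K - {0})"
proof -
  let ?z = "r *\<^sub>R x + (1 - r) *\<^sub>R x'"
  have zA: "?z \<in> A"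
    using x r by (intro convexD[OF convex_A]) auto
  have xK: "x \<in> K - {0}" "x' \<in> K - {0}"
    using x subset_cone by auto
  show ?thesis
  proof (cases "?z \<in> interior K")
    case True
    have half: "(1/2) *\<^sub>R y + (1/2) *\<^sub>R ?z \<in> A \<inter> interior K" if y: "y \<in> A" for y
    proof
      show "(1/2) *\<^sub>R y + (1/2) *\<^sub>R ?z \<in> A"
        using convexD[OF convex_A y zA, of "1/2" "1/2"] by simp
      show "(1/2) *\<^sub>R y + (1/2) *\<^sub>R ?z \<in> interior K"
        using y subset_cone by (intro translated_interior_mem[OF True] scale_mem) auto
    qed
    have "r *\<^sub>R (h *\<^sub>R x + h *\<^sub>R v) + (1 - r) *\<^sub>R (h *\<^sub>R x' + h *\<^sub>R v) = h *\<^sub>R ?z + h *\<^sub>R v"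
      for h :: real and v
      by (simp add: algebra_simps)
    from this[of "1/2" ?z]
    have regroup: "r *\<^sub>R ((1/2) *\<^sub>R x + (1/2) *\<^sub>R ?z) + (1 - r) *\<^sub>R ((1/2) *\<^sub>R x' + (1/2) *\<^sub>R ?z) = ?z"
      by (simp only: scaleR_add_left[symmetric]) simp
    have "r *\<^sub>R ((1/2) *\<^sub>R x + (1/2) *\<^sub>R ?z) + (1 - r) *\<^sub>R ((1/2) *\<^sub>R x' + (1/2) *\<^sub>R ?z) \<in> interior A"
      using x r by (intro strict half) auto
    also have "r *\<^sub>R ((1/2) *\<^sub>R x + (1/2) *\<^sub>R ?z) + (1 - r) *\<^sub>R ((1/2) *\<^sub>R x' + (1/2) *\<^sub>R ?z) = ?z"
      by (rule regroup)
    finally have int: "?z \<in> interior A" .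
    have "\<forall>\<^sub>F s in at_right (0::real). ?z - s *\<^sub>R x \<in> interior A"
      by (rule topological_tendstoD[of _ ?z]) (use int in \<open>auto intro!: tendsto_eq_intros\<close>)
    moreover have "\<forall>\<^sub>F s in at_right (0::real). s > 0"
      by (rule eventually_at_right_less)
    ultimately obtain s where s: "s > 0" "?z - s *\<^sub>R x \<in> interior A"
      using eventually_happens[OF eventually_conj] trivial_limit_at_right_real by blast
    have "(?z - s *\<^sub>R x) + s *\<^sub>R x \<in> A + (K - {0})"
    proof (rule set_plus_intro)
      show "?z - s *\<^sub>R x \<in> A"
        using s(2) interior_subset by blast
      show "s *\<^sub>R x \<in> K - {0}"
        using s(1) xK(1) scale_mem[of s x] by auto
    qed
    then show ?thesis by simp
  next
    case False
    obtain c where c: "c > 0" "x' = c *\<^sub>R x"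
      using boundary_segment_parallel[OF dim xK r False] by blast
    have "c \<noteq> 1"
      using x(3) c(2) by auto
    show ?thesis
    proof (cases "c > 1")
      case True
      have "x + ((1 - r) * (c - 1)) *\<^sub>R x \<in> A + (K - {0})"
      proof (rule set_plus_intro[OF x(1)])
        show "((1 - r) * (c - 1)) *\<^sub>R x \<in> K - {0}"
          using True r xK(1) scale_mem[of "(1 - r) * (c - 1)" x] by auto
      qed
      also have "x + ((1 - r) * (c - 1)) *\<^sub>R x = ?z"
        by (simp add: c(2) algebra_simps)
      finally show ?thesis .
    next
      case False
      have "x' + (r * (1 - c)) *\<^sub>R x \<in> A + (K - {0})"
      proof (rule set_plus_intro[OF x(2)])
        show "(r * (1 - c)) *\<^sub>R x \<in> K - {0}"
          using False \<open>c \<noteq> 1\<close> r xK(1) scale_mem[of "r * (1 - c)" x] by auto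
      qed
      also have "x' + (r * (1 - c)) *\<^sub>R x = ?z"
        by (simp add: c(2) algebra_simps)
      finally show ?thesis .
    qed
  qed
qed

text \<open>
  A functional negative on \<open>K - {0}\<close> is never maximal at a point of \<open>A + (K - {0})\<close>, whereas the midpoint of
  two maximizers would be maximal.
\<close>

lemma absorbed_segments_imp_differentiable:
  assumes "\<And>x x'. x \<in> A \<Longrightarrow> x' \<in> A \<Longrightarrow> x \<noteq> x' \<Longrightarrow> (1/2) *\<^sub>R x + (1/2) *\<^sub>R x' \<in> A + (K - {0})"
  shows "ereal_differentiable_on (support_fun A) (interior (neg_polar K))"
proof (rule unique_maximizer_imp_differentiable, rule ccontr)
  fix f u v
  assume f: "f \<in> interior (neg_polar K)" and u: "maximizer f u" and v: "maximizer f v" and "u \<noteq> v"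
  then have uv: "u \<in> A" "v \<in> A" "f v = f u"
    by (auto simp: maximizer_def intro: antisym)
  then obtain a k where ak: "a \<in> A" "k \<in> K - {0}" "(1/2) *\<^sub>R u + (1/2) *\<^sub>R v = a + k"
    using assms[OF uv(1,2) \<open>u \<noteq> v\<close>] by (auto elim!: set_plus_elim)
  have "f u = f ((1/2) *\<^sub>R u + (1/2) *\<^sub>R v)"
    using uv(3) by (simp add: blinfun.add_right blinfun.scaleR_right)
  also have "\<dots> = f a + f k"
    by (simp add: ak(3) blinfun.add_right)
  also have "\<dots> < f a"
    using f ak(2) by (simp add: interior_neg_polar_iff)
  also have "\<dots> \<le> f u"
    using u ak(1) by (simp add: maximizer_def)
  finally show False by simp
qed

end

section \<open>Differentiability of the support function and strict convexity\<close>

theorem theorem15: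
  fixes K A :: "'a::finite_dim_normed_space set"
  assumes "dim (UNIV :: 'a set) \<ge> 2"
    and "convex_cone K" and "closed K" and "pointed K" and "interior K \<noteq> {}"
    and "A \<noteq> {}" and "closed A" and "A = A + K" and "A \<subseteq> K - {0}"
    and "A + (K - {0}) \<subseteq> (top_of_set K) interior_of A"
  shows "(ereal_differentiable_on (support_fun A) (interior (neg_polar K)) \<longrightarrow>
            convex A \<and>
            (\<forall>a \<in> A \<inter> interior K. \<forall>a' \<in> A \<inter> interior K. a \<noteq> a' \<longrightarrow>
               (\<forall>r\<in>{0<..<1::real}. r *\<^sub>R a + (1 - r) *\<^sub>R a' \<in> interior A)))
       \<and> (dim (UNIV :: 'a set) = 2 \<and>
            (\<forall>a \<in> A \<inter> interior K. \<forall>a' \<in> A \<inter> interior K. a \<noteq> a' \<longrightarrow>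
               (\<forall>r\<in>{0<..<1::real}. r *\<^sub>R a + (1 - r) *\<^sub>R a' \<in> interior A)) \<longrightarrow>
            convex A \<and>
            (\<forall>x\<in>A. \<forall>x'\<in>A. x \<noteq> x' \<longrightarrow>
               (\<forall>r\<in>{0<..<1::real}. r *\<^sub>R x + (1 - r) *\<^sub>R x' \<in> A + (recession_cone A - {0}))) \<and>
            ereal_differentiable_on (support_fun A) (interior (neg_polar K)))"
proof -
  interpret relatively_absorbing_set K A
    using assms(2-) by unfold_locales
  show ?thesis
  proof (intro conjI impI; (elim conjE)?)
    assume diff: "ereal_differentiable_on (support_fun A) (interior (neg_polar K))"
    show "convex A"
      by (rule differentiable_imp_convex[OF diff])
    show "\<forall>a \<in> A \<inter> interior K. \<forall>a' \<in> A \<inter> interior K. a \<noteq> a' \<longrightarrow>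
               (\<forall>r\<in>{0<..<1::real}. r *\<^sub>R a + (1 - r) *\<^sub>R a' \<in> interior A)"
      using differentiable_imp_strict[OF diff] by simp
  next
    assume dim: "dim (UNIV :: 'a set) = 2"
      and strict: "\<forall>a \<in> A \<inter> interior K. \<forall>a' \<in> A \<inter> interior K. a \<noteq> a' \<longrightarrow>
               (\<forall>r\<in>{0<..<1::real}. r *\<^sub>R a + (1 - r) *\<^sub>R a' \<in> interior A)"
    show convex_A: "convex A"
    proof (rule convex_if_interior_segments)
      fix a a' and r :: real
      assume a: "a \<in> A \<inter> interior K" "a' \<in> A \<inter> interior K" and r: "0 < r" "r < 1"
      show "r *\<^sub>R a + (1 - r) *\<^sub>R a' \<in> A"
      proof (cases "a = a'")
        case True
        then show ?thesis
          using a by (simp flip: scaleR_add_left)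
      next
        case False
        then have "r *\<^sub>R a + (1 - r) *\<^sub>R a' \<in> interior A"
          using strict a r by simp
        then show ?thesis
          using interior_subset by blast
      qed
    qed
    have seg: "r *\<^sub>R x + (1 - r) *\<^sub>R x' \<in> A + (K - {0})"
      if "x \<in> A" "x' \<in> A" "x \<noteq> x'" "0 < r" "r < 1" for x x' and r :: real
      by (rule strict_imp_absorbed_segment[OF dim _ convex_A that]) (use strict in simp)
    show "ereal_differentiable_on (support_fun A) (interior (neg_polar K))"
      using seg[where r = "1/2"] by (intro absorbed_segments_imp_differentiable) simp
    have "A + (K - {0}) \<subseteq> A + (recession_cone A - {0})"
      using cone_subset_recession_cone by (intro set_plus_mono2) auto
    then show "\<forall>x\<in>A. \<forall>x'\<in>A. x \<noteq> x' \<longrightarrow>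
               (\<forall>r\<in>{0<..<1::real}. r *\<^sub>R x + (1 - r) *\<^sub>R x' \<in> A + (recession_cone A - {0}))"
      using seg by (auto simp: subset_iff)
  qed
qed
end
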